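(* Let $(X,\mathcal{B},\mathcal{E})$ be a measurable coarse space, let $\mu$ be a uniform measure on $(X,\mathcal{B})$ with respect to $\mathcal{E}$, and assume that the measure space $(X,\mu)$ is $\sigma$-finite. (1) Assume that $X$ has a $\mu$-PS and a quasi lattice $\Lambda\subset X$. Then $X$ has a Ponzi scheme. (2) Assume that $X$ has a Ponzi scheme $\theta$ such that $\operatorname{supp}\theta\subset S\times S$ for some uniform locally finite subset $S\subset X$, and that there exists a measurable controlled set $E\in\mathcal{E}\cap(\mathcal{B}\times\mathcal{B})$ which is constant on $S$ with respect to $\mu$. Then $X$ has a $\mu$-PS.
   Context: Notation: for $E,E_1,E_2\subset X\times X$ and $K\subset X$, $E^T=\{(x',x):(x,x')\in E\}$, $E_1\circ E_2=\{(x,z):(x,y)\in E_1,(y,z)\in E_2\text{ for some }y\in X\}$, $E[K]=\{y\in X:(x,y)\in E\text{ for some }x\in K\}$, $E_x=E[\{x\}]$. A coarse structure on $X$ is a collection $\mathcal{E}\subset\mathcal{P}(X\times X)$ containing the diagonal $\Delta_X$ and closed under subsets, finite unions, the product $\circ$ and the transpose. Its elements are called controlled sets. For a $\sigma$-algebra $\mathcal{B}$ on $X$, $\mathcal{B}\times\mathcal{B}$ is the product $\sigma$-algebra on $X\times X$. A measurable controlled set is an element of $\mathcal{E}\cap(\mathcal{B}\times\mathcal{B})$. The coarse structure $\mathcal{E}$ is measurable (and $(X,\mathcal{B},\mathcal{E})$ is a measurable coarse space) if every $E\in\mathcal{E}$ is contained in some $\tilde E\in\mathcal{E}\cap(\mathcal{B}\times\mathcal{B})$.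 A measure $\mu$ on $(X,\mathcal{B})$ is uniform with respect to $\mathcal{E}$ if $\sup_{x\in X}\mu(E_x)<\infty$ for every $E\in\mathcal{E}\cap(\mathcal{B}\times\mathcal{B})$. A subset $S\subset X$ is uniform locally finite if $\sup_{x\in X}\#(E_x\cap S)<\infty$ for every $E\in\mathcal{E}$. A quasi lattice is a uniform locally finite subset $\Lambda\subset X$ such that $X=E_0[\Lambda]$ for some $E_0\in\mathcal{E}$. A measurable controlled set $E$ is constant on $S\subset X$ with respect to $\mu$ if there is a constant $C>0$ with $\mu(E_s)=C$ for all $s\in S$. Ponzi schemes: a uniform 0-chain is a bounded function $\phi:X\to\mathbb{R}$ whose support is contained in some uniform locally finite subset $S$. It is effective if $\phi\ge 0$ and there is $E\in\mathcal{E}$ with $\sum_{s\in E_x\cap S}\phi(s)\ge 1$ for all $x\in X$. A uniform 1-chain is a bounded function $\theta:X\times X\to\mathbb{R}$ such that $\operatorname{supp}\theta\subset(S\times S)\cap E_\theta$ for some uniform locally finite subset $S$ and some $E_\theta\in\mathcal{E}$. Its boundary is the uniform 0-chain $\partial\theta(s)=\sum_{s'\in S}\theta(s',s)-\sum_{s'\in S}\theta(s,s')$. A Ponzi scheme is a uniform 1-chain $\theta$ whose boundary $\partial\theta$ is effective. $\mu$-PS: a $\mu$-0 chain is an element $f\in L^\infty(X,\mu)$ (real-valued). It is effective if $f\ge0$ $\mu$-a.e. and there is $E\in\mathcal{E}\cap(\mathcal{B}\times\mathcal{B})$ with $\int_{E_{x_0}}f\,d\mu\ge1$ for all $x_0\in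 X$. A $\mu$-1 chain is a function $c:X\times X\to\mathbb{R}$ that is essentially bounded with respect to $\mu\otimes\mu$ and for which there is $E_c\in\mathcal{E}\cap(\mathcal{B}\times\mathcal{B})$ with $\int_{X\times X\setminus E_c}|c|\,d\mu\otimes\mu=0$. Its boundary is the $\mu$-0 chain $\partial c(x)=\int_Xc(y,x)\,d\mu(y)-\int_Xc(x,y)\,d\mu(y)$. A $\mu$-PS is a $\mu$-1 chain $c$ whose boundary $\partial c$ is effective. *)

theory Defs
  imports "HOL-Analysis.Analysis"
begin

section \<open>Measurable coarse spaces\<close>

text \<open>For controlled sets the library operations are used: \<^term>\<open>E\<inverse>\<close> is the transpose,
  \<^term>\<open>E O F\<close> the product (in the order \<open>(x,y) \<in> E\<close>, \<open>(y,z) \<in> F\<close>), \<^term>\<open>E `` K\<close> is \<open>E[K]\<close>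
  and \<^term>\<open>E `` {x}\<close> is the section \<open>E\<^sub>x\<close>.  The underlying set of a measurable coarse space is
  \<^term>\<open>space M\<close>, its \<open>\<sigma>\<close>-algebra is \<^term>\<open>sets M\<close>.\<close>

definition coarse_structure :: "'a set \<Rightarrow> ('a \<times> 'a) set set \<Rightarrow> bool" where
  "coarse_structure X \<E> \<longleftrightarrow>
     \<E> \<subseteq> Pow (X \<times> X) \<and>
     Id_on X \<in> \<E> \<and>
     (\<forall>E\<in>\<E>. \<forall>F. F \<subseteq> E \<longrightarrow> F \<in> \<E>) \<and>
     (\<forall>E\<in>\<E>. \<forall>F\<in>\<E>. E \<union> F \<in> \<E>) \<and>
     (\<forall>E\<in>\<E>. \<forall>F\<in>\<E>. E O F \<in> \<E>) \<and>
     (\<forall>E\<in>\<E>. E\<inverse> \<in> \<E>)"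

definition measurable_controlled :: "'a measure \<Rightarrow> ('a \<times> 'a) set set \<Rightarrow> ('a \<times> 'a) set set" where
  "measurable_controlled M \<E> = \<E> \<inter> sets (M \<Otimes>\<^sub>M M)"

definition measurable_coarse_space :: "'a measure \<Rightarrow> ('a \<times> 'a) set set \<Rightarrow> bool" where
  "measurable_coarse_space M \<E> \<longleftrightarrow>
     coarse_structure (space M) \<E> \<and>
     (\<forall>E\<in>\<E>. \<exists>F\<in>measurable_controlled M \<E>. E \<subseteq> F)"

definition uniform_wrt :: "'a measure \<Rightarrow> ('a \<times> 'a) set set \<Rightarrow> bool" where
  "uniform_wrt M \<E> \<longleftrightarrow>
     (\<forall>E\<in>measurable_controlled M \<E>. (SUP x\<in>space M. emeasure M (E `` {x})) < \<infinity>)"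

definition uniform_locally_finite :: "'a set \<Rightarrow> ('a \<times> 'a) set set \<Rightarrow> 'a set \<Rightarrow> bool" where
  "uniform_locally_finite X \<E> S \<longleftrightarrow>
     S \<subseteq> X \<and>
     (\<forall>E\<in>\<E>. \<exists>N::nat. \<forall>x\<in>X. finite (E `` {x} \<inter> S) \<and> card (E `` {x} \<inter> S) \<le> N)"

definition quasi_lattice :: "'a set \<Rightarrow> ('a \<times> 'a) set set \<Rightarrow> 'a set \<Rightarrow> bool" where
  "quasi_lattice X \<E> \<Lambda> \<longleftrightarrow>
     uniform_locally_finite X \<E> \<Lambda> \<and> (\<exists>E\<in>\<E>. X = E `` \<Lambda>)"

definition measure_constant_on :: "'a measure \<Rightarrow> 'a set \<Rightarrow> ('a \<times> 'a) set \<Rightarrow> bool" where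
  "measure_constant_on M S E \<longleftrightarrow>
     (\<exists>C::real. 0 < C \<and> (\<forall>s\<in>S. emeasure M (E `` {s}) = ennreal C))"


section \<open>Ponzi schemes\<close>

text \<open>Only the values on the underlying set \<open>X\<close> (respectively \<open>X \<times> X\<close>) are relevant in the
  definitions below.\<close>

definition uniform_0_chain_on ::
    "'a set \<Rightarrow> ('a \<times> 'a) set set \<Rightarrow> 'a set \<Rightarrow> ('a \<Rightarrow> real) \<Rightarrow> bool" where
  "uniform_0_chain_on X \<E> S \<phi> \<longleftrightarrow>
     uniform_locally_finite X \<E> S \<and> bounded (\<phi> ` X) \<and> support_on X \<phi> \<subseteq> S"

definition effective_0_chain ::
    "'a set \<Rightarrow> ('a \<times> 'a) set set \<Rightarrow> ('a \<Rightarrow> real) \<Rightarrow> bool" where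
  "effective_0_chain X \<E> \<phi> \<longleftrightarrow>
     (\<exists>S. uniform_0_chain_on X \<E> S \<phi> \<and>
          (\<forall>x\<in>X. 0 \<le> \<phi> x) \<and>
          (\<exists>E\<in>\<E>. \<forall>x\<in>X. 1 \<le> (\<Sum>s\<in>E `` {x} \<inter> S. \<phi> s)))"

definition uniform_1_chain_on ::
    "'a set \<Rightarrow> ('a \<times> 'a) set set \<Rightarrow> 'a set \<Rightarrow> ('a \<times> 'a \<Rightarrow> real) \<Rightarrow> bool" where
  "uniform_1_chain_on X \<E> S \<theta> \<longleftrightarrow>
     uniform_locally_finite X \<E> S \<and>
     bounded (\<theta> ` (X \<times> X)) \<and>
     (\<exists>E\<in>\<E>. support_on (X \<times> X) \<theta> \<subseteq> (S \<times> S) \<inter> E)"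

text \<open>For a uniform 1-chain supported in \<open>S \<times> S\<close> both sums have only finitely many nonzero
  terms, but \<open>S\<close> itself may be infinite, in which case the finite-set \<^const>\<open>sum\<close> would
  be \<open>0\<close>; hence \<^const>\<open>infsum\<close>.  The values do not depend on the choice of \<open>S\<close>.\<close>

definition boundary :: "'a set \<Rightarrow> ('a \<times> 'a \<Rightarrow> real) \<Rightarrow> 'a \<Rightarrow> real" where
  "boundary S \<theta> s = (\<Sum>\<^sub>\<infinity>s'\<in>S. \<theta> (s', s)) - (\<Sum>\<^sub>\<infinity>s'\<in>S. \<theta> (s, s'))"

definition ponzi_scheme ::
    "'a set \<Rightarrow> ('a \<times> 'a) set set \<Rightarrow> ('a \<times> 'a \<Rightarrow> real) \<Rightarrow> bool" where
  "ponzi_scheme X \<E> \<theta> \<longleftrightarrow>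
     (\<exists>S. uniform_1_chain_on X \<E> S \<theta> \<and> effective_0_chain X \<E> (boundary S \<theta>))"


section \<open>Measure-theoretic Ponzi schemes\<close>

definition mu_0_chain :: "'a measure \<Rightarrow> ('a \<Rightarrow> real) \<Rightarrow> bool" where
  "mu_0_chain M f \<longleftrightarrow>
     f \<in> borel_measurable M \<and> (\<exists>C::real. AE x in M. \<bar>f x\<bar> \<le> C)"

definition effective_mu_0_chain ::
    "'a measure \<Rightarrow> ('a \<times> 'a) set set \<Rightarrow> ('a \<Rightarrow> real) \<Rightarrow> bool" where
  "effective_mu_0_chain M \<E> f \<longleftrightarrow>
     mu_0_chain M f \<and>
     (AE x in M. 0 \<le> f x) \<and>
     (\<exists>E\<in>measurable_controlled M \<E>. \<forall>x\<^sub>0\<in>space M. 1 \<le> (LINT x:E `` {x\<^sub>0}|M. f x))"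

text \<open>The nonnegative integral is used for the support condition because the Bochner integral
  of a non-integrable function is \<open>0\<close> by convention.\<close>

definition mu_1_chain ::
    "'a measure \<Rightarrow> ('a \<times> 'a) set set \<Rightarrow> ('a \<times> 'a \<Rightarrow> real) \<Rightarrow> bool" where
  "mu_1_chain M \<E> c \<longleftrightarrow>
     c \<in> borel_measurable (M \<Otimes>\<^sub>M M) \<and>
     (\<exists>C::real. AE p in M \<Otimes>\<^sub>M M. \<bar>c p\<bar> \<le> C) \<and>
     (\<exists>E\<in>measurable_controlled M \<E>.
        (\<integral>\<^sup>+p\<in>space M \<times> space M - E. ennreal \<bar>c p\<bar> \<partial>(M \<Otimes>\<^sub>M M)) = 0)"

text \<open>If \<open>M\<close> is \<open>\<sigma>\<close>-finite and uniform, both integrands are integrable for almost every \<open>x\<close>, so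
  the convention for non-integrable functions affects the boundary only on a null set.\<close>

definition mu_boundary :: "'a measure \<Rightarrow> ('a \<times> 'a \<Rightarrow> real) \<Rightarrow> 'a \<Rightarrow> real" where
  "mu_boundary M c x = (LINT y|M. c (y, x)) - (LINT y|M. c (x, y))"

definition mu_ponzi_scheme ::
    "'a measure \<Rightarrow> ('a \<times> 'a) set set \<Rightarrow> ('a \<times> 'a \<Rightarrow> real) \<Rightarrow> bool" where
  "mu_ponzi_scheme M \<E> c \<longleftrightarrow>
     mu_1_chain M \<E> c \<and> effective_mu_0_chain M \<E> (mu_boundary M c)"

end

theory Submission
  imports Defs
begin

text \<open>A 1-chain is a flow of money: \<open>c (x, y)\<close> is sent from \<open>x\<close> to \<open>y\<close> over a controlled distance, and the
  boundary is the net gain.  A Ponzi scheme lets everybody gain.  Both directions of the theorem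
  transport such a flow between \<open>X\<close> and a discrete subset, one by concentrating it, the other by
  smearing it out.

  Concentrating.  Every point of the space is controlled-close to a point of the quasi lattice
  \<open>\<Lambda>\<close>, so the space splits into measurable cells \<open>A s\<close>, \<open>s \<in> \<Lambda>\<close>, each inside a section \<open>D `` {s}\<close>.
  Put \<open>\<theta> (s, t) = \<integral>\<integral>\<^bsub>A s \<times> A t\<^esub> c\<close>.  By Fubini the money moved inside a cell cancels and
  \<open>\<partial>\<theta> s = \<integral>\<^bsub>A s\<^esub> \<partial>c\<close> (\<open>boundary_cells_flow\<close>); hence \<open>\<partial>\<theta>\<close> is nonnegative, and it is effective
  because every section of the set \<open>G\<close> witnessing that \<open>\<partial>c\<close> is effective is covered by the finitely
  many cells that it meets.  Uniformity of the measure bounds every quantity involved.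

  Smearing.  If all sections \<open>E `` {s}\<close>, \<open>s \<in> S\<close>, have the same measure \<open>C\<close>, replace the point \<open>s\<close> by
  the indicator of \<open>E `` {s}\<close>, that is \<open>c (x, y) = \<Sum>\<^bsub>s, t\<^esub> \<theta> (s, t) 1\<^bsub>E `` {s}\<^esub> x 1\<^bsub>E `` {t}\<^esub> y\<close>.
  Integrating one variable out multiplies by \<open>C\<close> irrespective of the point, so
  \<open>\<partial>c = C \<cdot> \<Sum>\<^bsub>s\<^esub> \<partial>\<theta> s 1\<^bsub>E `` {s}\<^esub>\<close> (\<open>mu_boundary_spread\<close>).  Its integral over a section of a
  controlled set containing \<open>F O E\<close> is at least \<open>C\<^sup>2\<close> times the sum of \<open>\<partial>\<theta>\<close> over the section of \<open>F\<close>
  in \<open>S\<close>, so dividing by \<open>C\<^sup>2\<close> gives an effective boundary.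

  The cells and the smeared flow are measurable because \<open>\<Lambda>\<close> and \<open>S\<close> are countable, and this
  follows from \<open>\<sigma>\<close>-finiteness, since a uniform locally finite set whose
  points have sections of positive measure is countable (\<open>countable_if_sections_positive\<close>).  For \<open>S\<close>
  take the sections of \<open>E\<close>; for \<open>\<Lambda>\<close> those of \<open>G\<close>, which carry integrals at least 1.\<close>


section \<open>Uniform measures on coarse spaces\<close>

locale uniform_coarse_space = sigma_finite_measure M
  for M :: "'a measure" +
  fixes \<E> :: "('a \<times> 'a) set set"
  assumes coarse: "measurable_coarse_space M \<E>"
    and unif: "uniform_wrt M \<E>"

sublocale uniform_coarse_space \<subseteq> square: pair_sigma_finite M M ..

context uniform_coarse_space
begin

lemma coarse_structure: "coarse_structure (space M) \<E>"
  using coarse by (simp add: measurable_coarse_space_def)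

lemma controlled_subset_space: "E \<in> \<E> \<Longrightarrow> E \<subseteq> space M \<times> space M"
  using coarse_structure by (auto simp: coarse_structure_def)

lemma controlled_Un: "E \<in> \<E> \<Longrightarrow> F \<in> \<E> \<Longrightarrow> E \<union> F \<in> \<E>"
  using coarse_structure by (simp add: coarse_structure_def)

lemma controlled_comp: "E \<in> \<E> \<Longrightarrow> F \<in> \<E> \<Longrightarrow> E O F \<in> \<E>"
  using coarse_structure by (simp add: coarse_structure_def)

lemma controlled_converse: "E \<in> \<E> \<Longrightarrow> E\<inverse> \<in> \<E>"
  using coarse_structure by (simp add: coarse_structure_def)

lemma measurable_controlledD:
  assumes "E \<in> measurable_controlled M \<E>"
  shows "E \<in> \<E>" "E \<in> sets (M \<Otimes>\<^sub>M M)"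
  using assms by (auto simp: measurable_controlled_def)

lemma converse_measurable:
  assumes "E \<in> sets (M \<Otimes>\<^sub>M M)"
  shows "E\<inverse> \<in> sets (M \<Otimes>\<^sub>M M)"
proof -
  have "E\<inverse> = (\<lambda>(x, y). (y, x)) -` E \<inter> space (M \<Otimes>\<^sub>M M)"
    using sets.sets_into_space[OF assms] by (auto simp: space_pair_measure)
  also have "\<dots> \<in> sets (M \<Otimes>\<^sub>M M)"
    using assms by (rule measurable_sets[OF measurable_pair_swap'])
  finally show ?thesis .
qed

lemma measurable_hull:
  assumes "E \<in> \<E>"
  obtains F where "F \<in> measurable_controlled M \<E>" "E \<subseteq> F"
  using assms coarse that by (auto simp: measurable_coarse_space_def)

lemma symmetric_measurable_hull:
  assumes "E \<in> \<E>"
  obtains F where "F \<in> measurable_controlled M \<E>" "E \<subseteq> F" "F\<inverse> = F"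
proof -
  obtain F where F: "F \<in> measurable_controlled M \<E>" "E \<subseteq> F"
    using assms by (rule measurable_hull)
  show ?thesis
  proof (rule that[of "F \<union> F\<inverse>"])
    show "F \<union> F\<inverse> \<in> measurable_controlled M \<E>"
      unfolding measurable_controlled_def
      using measurable_controlledD[OF F(1)]
      by (intro IntI controlled_Un controlled_converse sets.Un converse_measurable)
    show "E \<subseteq> F \<union> F\<inverse>" using F(2) by blast
    show "(F \<union> F\<inverse>)\<inverse> = F \<union> F\<inverse>"
      by (simp only: converse_Un converse_converse Un_commute)
  qed
qed

lemma section_measurable:
  assumes "E \<in> measurable_controlled M \<E>"
  shows "E `` {x} \<in> sets M"
proof -
  have "E `` {x} = Pair x -` E" by auto
  then show ?thesis by (simp only: sets_Pair1[OF measurable_controlledD(2)[OF assms]])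
qed

lemma section_emeasure_bounded:
  assumes "E \<in> measurable_controlled M \<E>"
  obtains K :: real where "0 \<le> K" "\<And>x. x \<in> space M \<Longrightarrow> emeasure M (E `` {x}) \<le> ennreal K"
proof -
  let ?K = "SUP x\<in>space M. emeasure M (E `` {x})"
  have fin: "?K < \<infinity>" using unif assms unfolding uniform_wrt_def by blast
  then have eq: "ennreal (enn2real ?K) = ?K" by simp
  show ?thesis
  proof (rule that[of "enn2real ?K"])
    show "emeasure M (E `` {x}) \<le> ennreal (enn2real ?K)" if "x \<in> space M" for x
      unfolding eq using that by (rule SUP_upper)
  qed simp
qed

lemma section_emeasure_finite:
  assumes "E \<in> measurable_controlled M \<E>"
  shows "emeasure M (E `` {x}) < \<infinity>"
proof (cases "x \<in> space M")
  case True
  obtain K :: real where "\<And>x. x \<in> space M \<Longrightarrow> emeasure M (E `` {x}) \<le> ennreal K"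
    using section_emeasure_bounded[OF assms] by blast
  from this[OF True] show ?thesis by (rule le_less_trans) simp
next
  case False
  then have "E `` {x} = {}"
    using controlled_subset_space measurable_controlledD(1)[OF assms] by blast
  then show ?thesis by simp
qed

text \<open>The definition bounds the sections at points of the space only; the others are empty.\<close>

lemma uniform_locally_finite_sections:
  assumes "uniform_locally_finite (space M) \<E> S" "E \<in> \<E>"
  shows "finite (E `` {x} \<inter> S)"
proof (cases "x \<in> space M")
  case True
  then show ?thesis using assms unfolding uniform_locally_finite_def by blast
next
  case False
  then have "E `` {x} = {}" using controlled_subset_space[OF assms(2)] by auto
  then show ?thesis by simp
qed

text \<open>Double counting: a point \<open>y\<close> lies in \<open>E `` {s}\<close> for at most \<open>N\<close> of the \<open>s \<in> S\<close>, namely those in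
  \<open>E\<inverse> `` {y}\<close>.\<close>

lemma sum_emeasure_sections_le:
  assumes E: "E \<in> measurable_controlled M \<E>" and B: "B \<in> sets M"
    and N: "\<And>y. y \<in> space M \<Longrightarrow> finite (E\<inverse> `` {y} \<inter> S) \<and> card (E\<inverse> `` {y} \<inter> S) \<le> N"
    and F: "finite F" "F \<subseteq> S"
  shows "(\<Sum>s\<in>F. emeasure M (E `` {s} \<inter> B)) \<le> of_nat N * emeasure M B"
proof -
  have meas: "E `` {s} \<inter> B \<in> sets M" for s using section_measurable[OF E] B by blast
  have "(\<Sum>s\<in>F. emeasure M (E `` {s} \<inter> B)) = (\<Sum>s\<in>F. \<integral>\<^sup>+y. indicator (E `` {s} \<inter> B) y \<partial>M)"
    using meas by simp
  also have "\<dots> = (\<integral>\<^sup>+y. (\<Sum>s\<in>F. indicator (E `` {s} \<inter> B) y) \<partial>M)"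
    using meas by (subst nn_integral_sum) auto
  also have "\<dots> \<le> (\<integral>\<^sup>+y. of_nat N * indicator B y \<partial>M)"
  proof (rule nn_integral_mono)
    fix y assume y: "y \<in> space M"
    have "(\<Sum>s\<in>F. indicator (E `` {s} \<inter> B) y :: ennreal)
        = (\<Sum>s\<in>{s \<in> F. (s, y) \<in> E}. indicator B y)"
      using F(1) by (intro sum.mono_neutral_cong_right) (auto simp: indicator_def)
    also have "\<dots> = of_nat (card {s \<in> F. (s, y) \<in> E}) * indicator B y" by simp
    also have "\<dots> \<le> of_nat N * indicator B y"
    proof (rule mult_right_mono)
      have "card {s \<in> F. (s, y) \<in> E} \<le> card (E\<inverse> `` {y} \<inter> S)"
        using N[OF y] F(2) by (intro card_mono) auto
      with N[OF y] show "(of_nat (card {s \<in> F. (s, y) \<in> E}) :: ennreal) \<le> of_nat N"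
        by (simp add: of_nat_le_iff)
    qed simp
    finally show "(\<Sum>s\<in>F. indicator (E `` {s} \<inter> B) y :: ennreal) \<le> of_nat N * indicator B y" .
  qed
  also have "\<dots> = of_nat N * emeasure M B"
    using B by (simp add: nn_integral_cmult_indicator)
  finally show ?thesis .
qed

text \<open>In a set \<open>B i\<close> of finite measure the numbers \<open>\<mu> (E `` {s} \<inter> B i)\<close> are summable over \<open>s \<in> S\<close> by the
  double counting above, so only countably many are positive; countably many such \<open>B i\<close> exhaust the
  space and every \<open>E `` {s}\<close> meets one of them in positive measure.\<close>

lemma countable_if_sections_positive:
  assumes S: "uniform_locally_finite (space M) \<E> S"
    and E: "E \<in> measurable_controlled M \<E>"
    and pos: "\<And>s. s \<in> S \<Longrightarrow> 0 < emeasure M (E `` {s})"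
  shows "countable S"
proof -
  obtain B :: "nat \<Rightarrow> 'a set"
    where B: "range B \<subseteq> sets M" "(\<Union>i. B i) = space M" "\<And>i. emeasure M (B i) \<noteq> \<infinity>"
    using sigma_finite by blast
  then have B': "B i \<in> sets M" for i by blast
  have "E\<inverse> \<in> \<E>" using E by (intro controlled_converse measurable_controlledD)
  then obtain N where N: "\<And>y. y \<in> space M \<Longrightarrow>
      finite (E\<inverse> `` {y} \<inter> S) \<and> card (E\<inverse> `` {y} \<inter> S) \<le> N"
    using S unfolding uniform_locally_finite_def by blast
  define P where "P i = {s \<in> S. emeasure M (E `` {s} \<inter> B i) \<noteq> 0}" for i
  have "countable (P i)" for i
  proof -
    let ?m = "\<lambda>s. measure M (E `` {s} \<inter> B i)"
    have fin: "emeasure M (E `` {s} \<inter> B i) = ennreal (?m s)" for s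
      using section_emeasure_finite[OF E, of s] emeasure_mono[of "E `` {s} \<inter> B i" "E `` {s}" M]
        section_measurable[OF E, of s]
      by (intro emeasure_eq_ennreal_measure) (auto simp: top_unique)
    have finB: "emeasure M (B i) = ennreal (measure M (B i))"
      using B(3)[of i] by (intro emeasure_eq_ennreal_measure) auto
    have "?m summable_on S"
    proof (rule nonneg_bdd_above_summable_on)
      have "sum ?m F \<le> real N * measure M (B i)" if "F \<subseteq> S" "finite F" for F
      proof -
        have "ennreal (sum ?m F) \<le> ennreal (real N * measure M (B i))"
          using sum_emeasure_sections_le[OF E B'[of i] N that(2,1)]
          by (simp add: fin finB ennreal_mult ennreal_of_nat_eq_real_of_nat)
        then show ?thesis by (subst (asm) ennreal_le_iff) auto
      qed
      then show "bdd_above (sum ?m ` {F. F \<subseteq> S \<and> finite F})" by (intro bdd_aboveI2) auto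
    qed simp
    then have "countable {s \<in> S. ?m s \<noteq> 0}" by (rule summable_countable_real)
    moreover have "P i \<subseteq> {s \<in> S. ?m s \<noteq> 0}" unfolding P_def fin by auto
    ultimately show ?thesis by (rule countable_subset[rotated])
  qed
  moreover have "S \<subseteq> (\<Union>i. P i)"
  proof
    fix s assume s: "s \<in> S"
    have "E `` {s} = (\<Union>i. E `` {s} \<inter> B i)"
      using B(2) sets.sets_into_space[OF section_measurable[OF E, of s]] by auto
    then have "(\<Union>i. E `` {s} \<inter> B i) \<notin> null_sets M"
      using pos[OF s] by (metis null_setsD1 less_irrefl)
    then obtain i where "E `` {s} \<inter> B i \<notin> null_sets M"
      by (metis null_sets_UN)
    then have "s \<in> P i"
      using s section_measurable[OF E, of s] B'[of i] by (auto simp: P_def null_sets_def)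
    then show "s \<in> (\<Union>i. P i)" by blast
  qed
  ultimately show ?thesis by (meson countable_UN countable_subset countableI_type)
qed

section \<open>Flow of a bounded 1-chain through a set\<close>

text \<open>Almost every row and almost every column of \<open>c\<close> and \<open>d\<close> agree almost everywhere; for the columns
  the product measure is transported along the swap of the two factors.\<close>

lemma mu_boundary_AE_cong:
  assumes [measurable]: "c \<in> borel_measurable (M \<Otimes>\<^sub>M M)" "d \<in> borel_measurable (M \<Otimes>\<^sub>M M)"
    and eq: "AE p in M \<Otimes>\<^sub>M M. c p = d p"
  shows "AE x in M. mu_boundary M c x = mu_boundary M d x"
proof -
  have 1: "AE x in M. AE y in M. c (x, y) = d (x, y)"
    using eq by (rule square.AE_pair)
  have "AE p in distr (M \<Otimes>\<^sub>M M) (M \<Otimes>\<^sub>M M) (\<lambda>(x, y). (y, x)). c p = d p"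
    using eq by (subst (asm) square.distr_pair_swap)
  then have "AE p in M \<Otimes>\<^sub>M M. c (case p of (x, y) \<Rightarrow> (y, x)) = d (case p of (x, y) \<Rightarrow> (y, x))"
    by (rule AE_distrD[OF measurable_pair_swap'])
  then have 2: "AE x in M. AE y in M. c (y, x) = d (y, x)"
    by (auto dest: square.AE_pair)
  from 1 2 AE_space show ?thesis
  proof eventually_elim
    case (elim x)
    then show ?case unfolding mu_boundary_def
      by (intro arg_cong2[where f = "(-)"] integral_cong_AE) (auto simp: measurable_Pair)
  qed
qed

lemma mu_boundary_measurable [measurable]:
  assumes [measurable]: "c \<in> borel_measurable (M \<Otimes>\<^sub>M M)"
  shows "mu_boundary M c \<in> borel_measurable M"
  unfolding mu_boundary_def by measurable

text \<open>The everywhere version of a 1-chain.  The support is taken symmetric so that exchanging source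
  and target again gives such a flow, which reduces statements about inflow to outflow.\<close>

definition bounded_flow :: "('a \<times> 'a) set \<Rightarrow> real \<Rightarrow> ('a \<times> 'a \<Rightarrow> real) \<Rightarrow> bool" where
  "bounded_flow E C d \<longleftrightarrow> d \<in> borel_measurable (M \<Otimes>\<^sub>M M) \<and> E \<in> measurable_controlled M \<E> \<and>
     E\<inverse> = E \<and> 0 \<le> C \<and> (\<forall>p. \<bar>d p\<bar> \<le> C * indicator E p)"

text \<open>Setting the chain to 0 where it exceeds its essential bound or leaves its support changes it on
  a null set only.\<close>

lemma mu_1_chain_representative:
  assumes "mu_1_chain M \<E> c"
  obtains d E C where "bounded_flow E C d" "AE p in M \<Otimes>\<^sub>M M. c p = d p"
proof -
  from assms obtain C :: real and F where cm[measurable]: "c \<in> borel_measurable (M \<Otimes>\<^sub>M M)"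
    and C: "AE p in M \<Otimes>\<^sub>M M. \<bar>c p\<bar> \<le> C" and F: "F \<in> measurable_controlled M \<E>"
    and int0: "(\<integral>\<^sup>+p\<in>space M \<times> space M - F. ennreal \<bar>c p\<bar> \<partial>(M \<Otimes>\<^sub>M M)) = 0"
    unfolding mu_1_chain_def by blast
  have [measurable]: "F \<in> sets (M \<Otimes>\<^sub>M M)" using F by (rule measurable_controlledD)
  have compl: "space M \<times> space M - F \<in> sets (M \<Otimes>\<^sub>M M)" by measurable
  obtain E where E: "E \<in> measurable_controlled M \<E>" "F \<subseteq> E" "E\<inverse> = E"
    using symmetric_measurable_hull measurable_controlledD(1)[OF F] .
  have [measurable]: "E \<in> sets (M \<Otimes>\<^sub>M M)" using E(1) by (rule measurable_controlledD)
  have "AE p in M \<Otimes>\<^sub>M M. ennreal \<bar>c p\<bar> * indicator (space M \<times> space M - F) p = 0"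
    using int0 by (subst (asm) nn_integral_0_iff_AE) (use compl in auto)
  then have "AE p in M \<Otimes>\<^sub>M M. p \<notin> F \<longrightarrow> c p = 0"
    using AE_space
  proof eventually_elim
    case (elim p)
    then show ?case by (auto simp: space_pair_measure indicator_def split: if_splits)
  qed
  then have off: "AE p in M \<Otimes>\<^sub>M M. p \<notin> E \<longrightarrow> c p = 0" using E(2) by auto
  \<comment> \<open>\<open>C\<close> may be negative when the product measure is zero.\<close>
  define D where "D = max 0 C"
  define d where "d p = (if p \<in> E \<and> \<bar>c p\<bar> \<le> D then c p else 0)" for p
  show ?thesis
  proof (rule that)
    have "d \<in> borel_measurable (M \<Otimes>\<^sub>M M)" unfolding d_def by measurable
    moreover have "0 \<le> D" by (simp add: D_def)
    moreover have "\<bar>d p\<bar> \<le> D * indicator E p" for p by (auto simp: d_def D_def)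
    ultimately show "bounded_flow E D d" using E by (simp add: bounded_flow_def)
    show "AE p in M \<Otimes>\<^sub>M M. c p = d p"
      using C off by eventually_elim (auto simp: d_def D_def)
  qed
qed

lemma bounded_flowD:
  assumes "bounded_flow E C d"
  shows "d \<in> borel_measurable (M \<Otimes>\<^sub>M M)" "E \<in> measurable_controlled M \<E>" "E\<inverse> = E"
    "0 \<le> C" "\<bar>d p\<bar> \<le> C * indicator E p"
  using assms by (simp_all add: bounded_flow_def del: split_paired_All)

lemma bounded_flow_eq_0:
  assumes "bounded_flow E C d" "p \<notin> E"
  shows "d p = 0"
  using bounded_flowD(5)[OF assms(1), of p] assms(2) by simp

lemma bounded_flow_swap:
  assumes "bounded_flow E C d"
  shows "bounded_flow E C (\<lambda>p. d (snd p, fst p))"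
proof -
  note [measurable] = bounded_flowD(1)[OF assms]
  have "(\<lambda>p. d (snd p, fst p)) \<in> borel_measurable (M \<Otimes>\<^sub>M M)" by measurable
  moreover have "(y, x) \<in> E \<longleftrightarrow> (x, y) \<in> E" for x y using bounded_flowD(3)[OF assms] by auto
  then have "\<bar>d (snd p, fst p)\<bar> \<le> C * indicator E p" for p
    using bounded_flowD(5)[OF assms, of "(snd p, fst p)"] by (cases p) (simp add: indicator_def)
  ultimately show ?thesis using assms by (simp add: bounded_flow_def)
qed

lemma bounded_flow_restrict:
  assumes d: "bounded_flow E C d" and [measurable]: "A \<in> sets M"
  shows "bounded_flow E C (\<lambda>p. indicator A (snd p) * d p)"
proof -
  note [measurable] = bounded_flowD(1)[OF d]
  have "(\<lambda>p. indicator A (snd p) * d p) \<in> borel_measurable (M \<Otimes>\<^sub>M M)" by measurable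
  moreover have "\<bar>indicator A (snd p) * d p\<bar> \<le> C * indicator E p" for p
    using bounded_flowD(4)[OF d] bounded_flowD(5)[OF d, of p] by (auto simp: indicator_def split: if_splits)
  ultimately show ?thesis using d by (simp add: bounded_flow_def)
qed

text \<open>The key use of a uniform measure: a source sends at most \<open>C\<close> per unit measure to targets in a
  section of measure at most \<open>K\<close>, so the total flow out of \<open>A\<close> is at most \<open>C \<cdot> K\<close> times the measure
  of \<open>A\<close>.\<close>

lemma nn_outflow_le:
  assumes d: "bounded_flow E C d" and A[measurable]: "A \<in> sets M"
    and K: "\<And>x. x \<in> space M \<Longrightarrow> emeasure M (E `` {x}) \<le> ennreal K"
  shows "(\<integral>\<^sup>+p. ennreal \<bar>indicator A (fst p) * d p\<bar> \<partial>(M \<Otimes>\<^sub>M M))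
    \<le> ennreal C * ennreal K * emeasure M A"
proof -
  note [measurable] = bounded_flowD(1)[OF d]
  note secE[measurable] = section_measurable[OF bounded_flowD(2)[OF d]]
  have "(\<integral>\<^sup>+p. ennreal \<bar>indicator A (fst p) * d p\<bar> \<partial>(M \<Otimes>\<^sub>M M))
      = (\<integral>\<^sup>+x. \<integral>\<^sup>+y. ennreal \<bar>indicator A x * d (x, y)\<bar> \<partial>M \<partial>M)"
    by (subst nn_integral_fst[symmetric]) auto
  also have "\<dots> \<le> (\<integral>\<^sup>+x. ennreal C * ennreal K * indicator A x \<partial>M)"
  proof (rule nn_integral_mono)
    fix x assume x: "x \<in> space M"
    have "(\<integral>\<^sup>+y. ennreal \<bar>indicator A x * d (x, y)\<bar> \<partial>M)
        \<le> (\<integral>\<^sup>+y. (ennreal C * indicator A x) * indicator (E `` {x}) y \<partial>M)"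
    proof (rule nn_integral_mono)
      fix y
      show "ennreal \<bar>indicator A x * d (x, y)\<bar>
          \<le> ennreal C * indicator A x * indicator (E `` {x}) y"
        using bounded_flowD(5)[OF d, of "(x, y)"]
        by (auto simp: indicator_def ennreal_leI split: if_splits)
    qed
    also have "\<dots> = (ennreal C * indicator A x) * emeasure M (E `` {x})"
      using secE by (rule nn_integral_cmult_indicator)
    also have "\<dots> \<le> (ennreal C * indicator A x) * ennreal K"
      using K[OF x] by (rule mult_left_mono) simp
    finally show "(\<integral>\<^sup>+y. ennreal \<bar>indicator A x * d (x, y)\<bar> \<partial>M)
        \<le> ennreal C * ennreal K * indicator A x" by (simp add: ac_simps)
  qed
  also have "\<dots> = ennreal C * ennreal K * emeasure M A"
    using A by (rule nn_integral_cmult_indicator)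
  finally show ?thesis .
qed

lemma integrable_outflow:
  assumes d: "bounded_flow E C d" and A[measurable]: "A \<in> sets M" and finA: "emeasure M A < \<infinity>"
  shows "integrable (M \<Otimes>\<^sub>M M) (\<lambda>p. indicator A (fst p) * d p)"
proof (rule integrableI_bounded)
  note [measurable] = bounded_flowD(1)[OF d]
  show "(\<lambda>p. indicator A (fst p) * d p) \<in> borel_measurable (M \<Otimes>\<^sub>M M)" by measurable
  obtain K :: real where K: "\<And>x. x \<in> space M \<Longrightarrow> emeasure M (E `` {x}) \<le> ennreal K"
    using section_emeasure_bounded[OF bounded_flowD(2)[OF d]] by blast
  have "ennreal C * ennreal K * emeasure M A < \<infinity>"
    using finA by (simp add: ennreal_mult_less_top)
  with nn_outflow_le[OF d A K]
  show "(\<integral>\<^sup>+p. ennreal (norm (indicator A (fst p) * d p)) \<partial>(M \<Otimes>\<^sub>M M)) < \<infinity>"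
    unfolding real_norm_def by (rule le_less_trans)
qed

lemma outflow_le:
  assumes d: "bounded_flow E C d" and A: "A \<in> sets M" "emeasure M A \<le> ennreal L" "0 \<le> L"
    and K: "0 \<le> K" "\<And>x. x \<in> space M \<Longrightarrow> emeasure M (E `` {x}) \<le> ennreal K"
  shows "\<bar>LINT p|(M \<Otimes>\<^sub>M M). indicator A (fst p) * d p\<bar> \<le> C * K * L"
proof -
  have "emeasure M A < \<infinity>" using A(2) by (rule le_less_trans) simp
  then have "ennreal \<bar>LINT p|(M \<Otimes>\<^sub>M M). indicator A (fst p) * d p\<bar>
      \<le> (\<integral>\<^sup>+p. ennreal \<bar>indicator A (fst p) * d p\<bar> \<partial>(M \<Otimes>\<^sub>M M))"
    using integral_norm_bound_ennreal[OF integrable_outflow[OF d A(1)]] by (simp only: real_norm_def)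
  also have "\<dots> \<le> ennreal C * ennreal K * emeasure M A"
    using d A(1) K(2) by (rule nn_outflow_le)
  also have "\<dots> \<le> ennreal C * ennreal K * ennreal L"
    using A(2) by (rule mult_left_mono) simp
  also have "\<dots> = ennreal (C * K * L)"
    using bounded_flowD(4)[OF d] K(1) A(3) by (simp add: ennreal_mult)
  finally show ?thesis
    using bounded_flowD(4)[OF d] K(1) A(3) by (subst (asm) ennreal_le_iff) auto
qed

lemma integral_swap:
  fixes f :: "'a \<times> 'a \<Rightarrow> real"
  assumes "f \<in> borel_measurable (M \<Otimes>\<^sub>M M)"
  shows "(LINT p|(M \<Otimes>\<^sub>M M). f (snd p, fst p)) = (LINT p|(M \<Otimes>\<^sub>M M). f p)"
  using square.integral_product_swap[OF assms] by (simp add: split_beta')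

lemma inflow_eq_outflow_swap:
  assumes d: "bounded_flow E C d" and [measurable]: "A \<in> sets M"
  shows "(LINT p|(M \<Otimes>\<^sub>M M). indicator A (snd p) * d p)
       = (LINT p|(M \<Otimes>\<^sub>M M). indicator A (fst p) * d (snd p, fst p))"
proof -
  note [measurable] = bounded_flowD(1)[OF d]
  have "(\<lambda>p. indicator A (fst p) * d (snd p, fst p)) \<in> borel_measurable (M \<Otimes>\<^sub>M M)" by measurable
  from integral_swap[OF this] show ?thesis by simp
qed

text \<open>The total net gain of \<open>A\<close> is inflow minus outflow; this is Fubini, available because both flows
  are integrable for \<open>A\<close> of finite measure.\<close>

lemma integral_mu_boundary:
  assumes d: "bounded_flow E C d" and A[measurable]: "A \<in> sets M" and finA: "emeasure M A < \<infinity>"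
  shows "set_integrable M A (mu_boundary M d)"
    and "(LINT x:A|M. mu_boundary M d x)
       = (LINT p|(M \<Otimes>\<^sub>M M). indicator A (snd p) * d p) - (LINT p|(M \<Otimes>\<^sub>M M). indicator A (fst p) * d p)"
proof -
  note out = integrable_outflow[OF d A finA]
  note inn = integrable_outflow[OF bounded_flow_swap[OF d] A finA]
  have eq: "(\<lambda>x. indicator A x *\<^sub>R mu_boundary M d x)
    = (\<lambda>x. (LINT y|M. indicator A x * d (y, x)) - (LINT y|M. indicator A x * d (x, y)))"
    by (simp add: mu_boundary_def right_diff_distrib)
  have o: "integrable M (\<lambda>x. LINT y|M. indicator A x * d (x, y))"
    using square.integrable_fst'[OF out] by simp
  have i: "integrable M (\<lambda>x. LINT y|M. indicator A x * d (y, x))"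
    using square.integrable_fst'[OF inn] by simp
  show "set_integrable M A (mu_boundary M d)"
    unfolding set_integrable_def eq using i o by (rule Bochner_Integration.integrable_diff)
  show "(LINT x:A|M. mu_boundary M d x)
       = (LINT p|(M \<Otimes>\<^sub>M M). indicator A (snd p) * d p) - (LINT p|(M \<Otimes>\<^sub>M M). indicator A (fst p) * d p)"
    unfolding set_lebesgue_integral_def eq Bochner_Integration.integral_diff[OF i o]
    using square.integral_fst'[OF out] square.integral_fst'[OF inn]
    by (simp add: inflow_eq_outflow_swap[OF d A])
qed


section \<open>From a mu-Ponzi scheme to a Ponzi scheme\<close>

text \<open>The usual disjointification: a point goes to the first element of \<open>\<Lambda>\<close>, in a fixed enumeration,
  whose section contains it.\<close>

lemma measurable_cells:
  assumes "countable \<Lambda>" and E: "E \<in> measurable_controlled M \<E>" and cover: "space M = E `` \<Lambda>"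
  obtains A where "\<And>s. A s \<in> sets M" "\<And>s. A s \<subseteq> E `` {s}"
    "\<And>x. x \<in> space M \<Longrightarrow> \<exists>s\<in>\<Lambda>. x \<in> A s" "disjoint_family_on A \<Lambda>"
proof
  let ?n = "to_nat_on \<Lambda>"
  let ?A = "\<lambda>s. E `` {s} - (\<Union>t\<in>{t \<in> \<Lambda>. ?n t < ?n s}. E `` {t})"
  have "(\<Union>t\<in>{t \<in> \<Lambda>. ?n t < ?n s}. E `` {t}) \<in> sets M" for s
    using assms(1) section_measurable[OF E] by (intro sets.countable_UN') auto
  then show "?A s \<in> sets M" for s using section_measurable[OF E] by (intro sets.Diff)
  show "?A s \<subseteq> E `` {s}" for s by blast
  show "\<exists>s\<in>\<Lambda>. x \<in> ?A s" if "x \<in> space M" for x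
  proof -
    from that cover have "x \<in> E `` \<Lambda>" by simp
    then obtain s0 where s0: "s0 \<in> \<Lambda> \<and> (s0, x) \<in> E" by auto
    define s where "s = arg_min ?n (\<lambda>s. s \<in> \<Lambda> \<and> (s, x) \<in> E)"
    have s: "s \<in> \<Lambda> \<and> (s, x) \<in> E" 
      unfolding s_def using s0 by (rule arg_min_natI[where P = "\<lambda>s. s \<in> \<Lambda> \<and> (s, x) \<in> E"])
    have "?n s \<le> ?n t" if "t \<in> \<Lambda> \<and> (t, x) \<in> E" for t
      unfolding s_def using that by (rule arg_min_nat_le)
    then have "x \<notin> (\<Union>t\<in>{t \<in> \<Lambda>. ?n t < ?n s}. E `` {t})" by fastforce
    with s show ?thesis by (intro bexI[of _ s]) simp_all
  qed
  show "disjoint_family_on ?A \<Lambda>"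
    unfolding disjoint_family_on_def
  proof (intro ballI impI)
    fix s t assume st: "s \<in> \<Lambda>" "t \<in> \<Lambda>" "s \<noteq> t"
    then have "?n s \<noteq> ?n t" using assms(1) by simp
    then consider "?n s < ?n t" | "?n t < ?n s" by linarith
    then show "?A s \<inter> ?A t = {}" using st by cases auto
  qed
qed

text \<open>Only finitely many target cells \<open>A t\<close> receive anything from \<open>A s\<close>, and together they receive the
  whole outflow; so the infinite sum is a finite sum of integrals, and this commutes with the
  integral.\<close>

lemma infsum_cells_outflow:
  assumes d: "bounded_flow E C d"
    and A: "\<And>t. A t \<in> sets M" "\<And>t. emeasure M (A t) < \<infinity>"
    and disj: "disjoint_family_on A \<Lambda>" and cover: "\<And>x. x \<in> space M \<Longrightarrow> \<exists>t\<in>\<Lambda>. x \<in> A t"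
    and fin: "finite {t \<in> \<Lambda>. E \<inter> A s \<times> A t \<noteq> {}}"
  shows "(\<Sum>\<^sub>\<infinity>t\<in>\<Lambda>. LINT p|(M \<Otimes>\<^sub>M M). indicator (A s) (fst p) * (indicator (A t) (snd p) * d p))
       = (LINT p|(M \<Otimes>\<^sub>M M). indicator (A s) (fst p) * d p)"
proof -
  let ?F = "{t \<in> \<Lambda>. E \<inter> A s \<times> A t \<noteq> {}}"
  let ?I = "\<lambda>t. LINT p|(M \<Otimes>\<^sub>M M). indicator (A s) (fst p) * (indicator (A t) (snd p) * d p)"
  have "?I t = 0" if "t \<in> \<Lambda> - ?F" for t
  proof -
    have "indicator (A s) (fst p) * (indicator (A t) (snd p) * d p) = 0" for p
      using that bounded_flow_eq_0[OF d, of p] by (cases p) (auto simp: indicator_def)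
    then show ?thesis by (simp only: Bochner_Integration.integral_zero)
  qed
  then have "infsum ?I \<Lambda> = sum ?I ?F"
    by (subst infsum_finite[OF fin, symmetric]) (rule infsum_cong_neutral, auto)
  also have "\<dots> = (LINT p|(M \<Otimes>\<^sub>M M).
      (\<Sum>t\<in>?F. indicator (A s) (fst p) * (indicator (A t) (snd p) * d p)))"
    by (rule Bochner_Integration.integral_sum[symmetric])
       (rule integrable_outflow[OF bounded_flow_restrict[OF d A(1)] A])
  also have "\<dots> = (LINT p|(M \<Otimes>\<^sub>M M). indicator (A s) (fst p) * d p)"
  proof (rule Bochner_Integration.integral_cong[OF refl])
    fix p assume "p \<in> space (M \<Otimes>\<^sub>M M)"
    then have p2: "snd p \<in> space M" by (auto simp: space_pair_measure)
    have "disjoint_family_on A ?F" using disj by (auto simp: disjoint_family_on_def)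
    then have "(\<Sum>t\<in>?F. indicator (A s) (fst p) * (indicator (A t) (snd p) * d p))
        = indicator (A s) (fst p) * (indicator (\<Union>t\<in>?F. A t) (snd p) * d p)"
      by (simp add: indicator_UN_disjoint[OF fin] sum_distrib_left sum_distrib_right)
    also have "\<dots> = indicator (A s) (fst p) * d p"
    proof (cases "fst p \<in> A s \<and> p \<in> E")
      case True
      obtain t where "t \<in> \<Lambda>" "snd p \<in> A t" using cover[OF p2] by blast
      with True have "snd p \<in> (\<Union>t\<in>?F. A t)" by (cases p) auto
      then show ?thesis by simp
    next
      case False
      then show ?thesis using bounded_flow_eq_0[OF d, of p] by auto
    qed
    finally show "(\<Sum>t\<in>?F. indicator (A s) (fst p) * (indicator (A t) (snd p) * d p))
        = indicator (A s) (fst p) * d p" .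
  qed
  finally show ?thesis .
qed

text \<open>Inflow is outflow of the swapped chain, so the preceding lemma computes both sums.\<close>

lemma boundary_cells_flow:
  assumes d: "bounded_flow E C d"
    and A: "\<And>t. A t \<in> sets M" "\<And>t. emeasure M (A t) < \<infinity>"
    and disj: "disjoint_family_on A \<Lambda>" and cover: "\<And>x. x \<in> space M \<Longrightarrow> \<exists>t\<in>\<Lambda>. x \<in> A t"
    and fin: "finite {t \<in> \<Lambda>. E \<inter> A s \<times> A t \<noteq> {}}"
  shows "boundary \<Lambda> (\<lambda>(s, t). LINT p|(M \<Otimes>\<^sub>M M).
           indicator (A s) (fst p) * (indicator (A t) (snd p) * d p)) s
       = (LINT x:A s|M. mu_boundary M d x)"
proof -
  note [measurable] = A(1) bounded_flowD(1)[OF d]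
  let ?d' = "\<lambda>p. d (snd p, fst p)"
  have "(LINT p|(M \<Otimes>\<^sub>M M). indicator (A t) (fst p) * (indicator (A s) (snd p) * d p))
      = (LINT p|(M \<Otimes>\<^sub>M M). indicator (A s) (fst p) * (indicator (A t) (snd p) * ?d' p))" for t
  proof -
    have "(\<lambda>p. indicator (A t) (fst p) * (indicator (A s) (snd p) * d p)) \<in> borel_measurable (M \<Otimes>\<^sub>M M)"
      by measurable
    from integral_swap[OF this] show ?thesis by (simp add: ac_simps)
  qed
  then show ?thesis
    unfolding boundary_def
    using infsum_cells_outflow[OF d A disj cover fin]
      infsum_cells_outflow[OF bounded_flow_swap[OF d] A disj cover fin]
      integral_mu_boundary(2)[OF d A]
    by (simp add: inflow_eq_outflow_swap[OF d A(1)])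
qed

text \<open>Integrate a representative of the chain over products of cells.  The distance between cells
  exchanging money is controlled by \<open>D O E O D\<inverse>\<close>: from a lattice point to its cell, along the flow,
  and back to a lattice point.\<close>

theorem ponzi_scheme_from_mu_ponzi_scheme:
  assumes c: "mu_ponzi_scheme M \<E> c" and "quasi_lattice (space M) \<E> \<Lambda>"
  shows "\<exists>\<theta>. ponzi_scheme (space M) \<E> \<theta>"
proof -
  have ulf: "uniform_locally_finite (space M) \<E> \<Lambda>" and "\<exists>E\<in>\<E>. space M = E `` \<Lambda>"
    using assms(2) by (auto simp: quasi_lattice_def)
  then obtain E0 where "E0 \<in> \<E>" "space M = E0 `` \<Lambda>" by blast
  moreover obtain D where D: "D \<in> measurable_controlled M \<E>" "E0 \<subseteq> D"
    using measurable_hull[OF \<open>E0 \<in> \<E>\<close>] .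
  ultimately have cover_D: "space M = D `` \<Lambda>"
    using controlled_subset_space[OF measurable_controlledD(1)[OF D(1)]] by blast
  have \<Lambda>: "\<Lambda> \<subseteq> space M" using ulf by (simp add: uniform_locally_finite_def)

  have chain: "mu_1_chain M \<E> c" and cm[measurable]: "c \<in> borel_measurable (M \<Otimes>\<^sub>M M)"
    using c by (auto simp: mu_ponzi_scheme_def mu_1_chain_def)
  have nonneg: "AE x in M. 0 \<le> mu_boundary M c x"
    and "\<exists>G\<in>measurable_controlled M \<E>. \<forall>x\<in>space M. 1 \<le> (LINT y:G `` {x}|M. mu_boundary M c y)"
    using c by (auto simp: mu_ponzi_scheme_def effective_mu_0_chain_def)
  then obtain G where G: "G \<in> measurable_controlled M \<E>"
    and eff: "\<And>x. x \<in> space M \<Longrightarrow> 1 \<le> (LINT y:G `` {x}|M. mu_boundary M c y)" by blast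
  note secG[measurable] = section_measurable[OF G]

  \<comment> \<open>A null section of \<open>G\<close> would carry the integral 0, not at least 1.\<close>
  have "countable \<Lambda>"
  proof (rule countable_if_sections_positive[OF ulf G])
    fix s assume "s \<in> \<Lambda>"
    show "0 < emeasure M (G `` {s})"
    proof (rule ccontr)
      assume "\<not> 0 < emeasure M (G `` {s})"
      then have "G `` {s} \<in> null_sets M" using secG by (auto simp: null_sets_def)
      then have "AE y in M. y \<notin> G `` {s}" by (rule AE_not_in)
      then have "(LINT y:G `` {s}|M. mu_boundary M c y) = 0"
        unfolding set_lebesgue_integral_def
        by (intro integral_eq_zero_AE) (auto simp: indicator_def)
      with eff \<open>s \<in> \<Lambda>\<close> \<Lambda> show False by force
    qed
  qed
  obtain A where A: "\<And>s. A s \<in> sets M" "\<And>s. A s \<subseteq> D `` {s}"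
    "\<And>x. x \<in> space M \<Longrightarrow> \<exists>s\<in>\<Lambda>. x \<in> A s" "disjoint_family_on A \<Lambda>"
    using measurable_cells[OF \<open>countable \<Lambda>\<close> D(1) cover_D] by blast
  have finA: "emeasure M (A s) < \<infinity>" for s
    using emeasure_mono[OF A(2) section_measurable[OF D(1)]] section_emeasure_finite[OF D(1)]
    by (rule le_less_trans)

  obtain d E C where d: "bounded_flow E C d" and cd: "AE p in M \<Otimes>\<^sub>M M. c p = d p"
    using mu_1_chain_representative[OF chain] .
  note [measurable] = bounded_flowD(1)[OF d]
  let ?g = "mu_boundary M d"
  have fg: "AE x in M. mu_boundary M c x = ?g x"
    using cm bounded_flowD(1)[OF d] cd by (rule mu_boundary_AE_cong)
  then have g_nonneg: "AE x in M. 0 \<le> ?g x" using nonneg by eventually_elim simp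
  have effg: "1 \<le> (LINT y:G `` {x}|M. ?g y)" if "x \<in> space M" for x
  proof -
    have "(LINT y:G `` {x}|M. ?g y) = (LINT y:G `` {x}|M. mu_boundary M c y)"
      by (rule set_lebesgue_integral_cong_AE) (use fg in auto)
    then show ?thesis using eff[OF that] by simp
  qed

  obtain K where K: "0 \<le> K" "\<And>x. x \<in> space M \<Longrightarrow> emeasure M (E `` {x}) \<le> ennreal K"
    using section_emeasure_bounded[OF bounded_flowD(2)[OF d]] by blast
  obtain L where L: "0 \<le> L" "\<And>x. x \<in> space M \<Longrightarrow> emeasure M (D `` {x}) \<le> ennreal L"
    using section_emeasure_bounded[OF D(1)] by blast
  have AL: "emeasure M (A s) \<le> ennreal L" if "s \<in> \<Lambda>" for s
    using emeasure_mono[OF A(2) section_measurable[OF D(1)]] L(2)[OF subsetD[OF \<Lambda> that]]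
    by (rule order_trans)

  define N where "N = D O E O D\<inverse>"
  have N: "N \<in> \<E>"
    unfolding N_def using measurable_controlledD(1) D(1) bounded_flowD(2)[OF d]
    by (intro controlled_comp controlled_converse) auto
  have near: "(s, t) \<in> N" if "E \<inter> A s \<times> A t \<noteq> {}" for s t
  proof -
    from that obtain x y where "(x, y) \<in> E" "x \<in> A s" "y \<in> A t" by auto
    then show ?thesis using A(2) unfolding N_def by (intro relcompI[of s x] relcompI[of x y]) auto
  qed
  have finN: "finite {t \<in> \<Lambda>. E \<inter> A s \<times> A t \<noteq> {}}" for s
    by (rule finite_subset[OF _ uniform_locally_finite_sections[OF ulf N, of s]]) (use near in blast)

  \<comment> \<open>Off \<open>\<Lambda> \<times> \<Lambda>\<close>, where \<open>A s\<close> and \<open>A t\<close> may still be nonempty,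
    the chain has to vanish, hence the cut-off \<open>\<theta>\<close>.\<close>
  define \<theta>0 where "\<theta>0 = (\<lambda>(s, t). LINT p|(M \<Otimes>\<^sub>M M).
      indicator (A s) (fst p) * (indicator (A t) (snd p) * d p))"
  define \<theta> where "\<theta> p = (if p \<in> \<Lambda> \<times> \<Lambda> then \<theta>0 p else 0)" for p
  have \<theta>0_near: "p \<in> N" if "\<theta>0 p \<noteq> 0" for p
  proof (cases p)
    case (Pair s t)
    show ?thesis
    proof (rule ccontr)
      assume "p \<notin> N"
      then have "E \<inter> A s \<times> A t = {}" using near Pair by blast
      then have "indicator (A s) (fst q) * (indicator (A t) (snd q) * d q) = 0" for q
        using bounded_flow_eq_0[OF d, of q] by (cases q) (auto simp: indicator_def)
      then have "\<theta>0 p = 0"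
        unfolding \<theta>0_def Pair prod.case by (simp only: Bochner_Integration.integral_zero)
      with that show False by simp
    qed
  qed
  have bound_\<theta>: "\<bar>\<theta> p\<bar> \<le> C * K * L" for p
  proof (cases "p \<in> \<Lambda> \<times> \<Lambda>")
    case True
    then show ?thesis
      using outflow_le[OF bounded_flow_restrict[OF d A(1)] A(1) AL L(1) K]
      by (cases p) (auto simp: \<theta>_def \<theta>0_def)
  next
    case False
    then show ?thesis using bounded_flowD(4)[OF d] K(1) L(1) by (simp add: \<theta>_def)
  qed
  have chain\<theta>: "uniform_1_chain_on (space M) \<E> \<Lambda> \<theta>"
    unfolding uniform_1_chain_on_def
  proof (intro conjI)
    show "bounded (\<theta> ` (space M \<times> space M))"
      using bound_\<theta> by (intro boundedI[of _ "C * K * L"]) auto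
    have "support_on (space M \<times> space M) \<theta> \<subseteq> (\<Lambda> \<times> \<Lambda>) \<inter> N"
    proof
      fix p assume "p \<in> support_on (space M \<times> space M) \<theta>"
      then have "\<theta> p \<noteq> 0" by (simp add: support_on_def)
      then show "p \<in> (\<Lambda> \<times> \<Lambda>) \<inter> N" using \<theta>0_near[of p] by (auto simp: \<theta>_def split: if_splits)
    qed
    then show "\<exists>E\<in>\<E>. support_on (space M \<times> space M) \<theta> \<subseteq> (\<Lambda> \<times> \<Lambda>) \<inter> E" using N by blast
  qed (fact ulf)

  have bd: "boundary \<Lambda> \<theta> s = (LINT x:A s|M. ?g x)" if "s \<in> \<Lambda>" for s
  proof -
    have "boundary \<Lambda> \<theta> s = boundary \<Lambda> \<theta>0 s"
      unfolding boundary_def using that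
      by (intro arg_cong2[where f = "(-)"] infsum_cong) (auto simp: \<theta>_def)
    also have "\<dots> = (LINT x:A s|M. ?g x)"
      unfolding \<theta>0_def by (rule boundary_cells_flow[OF d A(1) finA A(4,3) finN])
    finally show ?thesis .
  qed
  have bd_out: "boundary \<Lambda> \<theta> s = 0" if "s \<notin> \<Lambda>" for s
    using that by (simp add: boundary_def \<theta>_def)
  have g_int: "set_integrable M B ?g" if "B \<in> sets M" "emeasure M B < \<infinity>" for B
    using integral_mu_boundary(1)[OF d that] .

  have "effective_0_chain (space M) \<E> (boundary \<Lambda> \<theta>)"
    unfolding effective_0_chain_def
  proof (intro exI conjI ballI)
    have "\<bar>boundary \<Lambda> \<theta> s\<bar> \<le> C * K * L + C * K * L" for s
    proof (cases "s \<in> \<Lambda>")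
      case True
      have "boundary \<Lambda> \<theta> s = (LINT p|(M \<Otimes>\<^sub>M M). indicator (A s) (fst p) * d (snd p, fst p))
          - (LINT p|(M \<Otimes>\<^sub>M M). indicator (A s) (fst p) * d p)"
        unfolding bd[OF True] integral_mu_boundary(2)[OF d A(1) finA] inflow_eq_outflow_swap[OF d A(1)] ..
      then show ?thesis
        using outflow_le[OF d A(1) AL[OF True] L(1) K]
          outflow_le[OF bounded_flow_swap[OF d] A(1) AL[OF True] L(1) K] by linarith
    next
      case False
      then show ?thesis using bounded_flowD(4)[OF d] K(1) L(1) by (simp add: bd_out)
    qed
    then have "bounded (boundary \<Lambda> \<theta> ` space M)"
      by (intro boundedI[of _ "C * K * L + C * K * L"]) auto
    then show "uniform_0_chain_on (space M) \<E> \<Lambda> (boundary \<Lambda> \<theta>)"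
      using ulf bd_out by (auto simp: uniform_0_chain_on_def support_on_def)
    show "0 \<le> boundary \<Lambda> \<theta> s" for s
    proof (cases "s \<in> \<Lambda>")
      case True
      show ?thesis unfolding bd[OF True] set_lebesgue_integral_def
        by (rule integral_nonneg_AE) (use g_nonneg in \<open>auto simp: indicator_def\<close>)
    qed (simp add: bd_out)
    \<comment> \<open>If \<open>y \<in> G `` {x}\<close> lies in the cell of \<open>s\<close>, then \<open>(x, s) \<in> G O D\<inverse>\<close>.\<close>
    have E': "G O D\<inverse> \<in> \<E>"
      using measurable_controlledD(1)[OF G] measurable_controlledD(1)[OF D(1)]
      by (intro controlled_comp controlled_converse)
    have "1 \<le> (\<Sum>s\<in>(G O D\<inverse>) `` {x} \<inter> \<Lambda>. boundary \<Lambda> \<theta> s)" if x: "x \<in> space M" for x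
    proof -
      let ?F = "(G O D\<inverse>) `` {x} \<inter> \<Lambda>"
      have fin: "finite ?F" using ulf E' by (rule uniform_locally_finite_sections)
      have "G `` {x} \<subseteq> (\<Union>s\<in>?F. A s)"
      proof
        fix y assume y: "y \<in> G `` {x}"
        then have "y \<in> space M" using controlled_subset_space[OF measurable_controlledD(1)[OF G]] by blast
        then obtain s where "s \<in> \<Lambda>" "y \<in> A s" using A(3) by blast
        with y A(2)[of s] show "y \<in> (\<Union>s\<in>?F. A s)" by blast
      qed
      have "1 \<le> (LINT y:G `` {x}|M. ?g y)" using x by (rule effg)
      also have "\<dots> \<le> (LINT y:(\<Union>s\<in>?F. A s)|M. ?g y)"
        unfolding set_lebesgue_integral_def
      proof (rule integral_mono_AE)
        show "integrable M (\<lambda>y. indicator (G `` {x}) y *\<^sub>R ?g y)"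
          using g_int[OF secG section_emeasure_finite[OF G]] by (simp add: set_integrable_def)
        show "integrable M (\<lambda>y. indicator (\<Union>s\<in>?F. A s) y *\<^sub>R ?g y)"
          using set_integrable_UN[OF fin g_int[OF A(1) finA] A(1)] by (simp add: set_integrable_def)
        show "AE y in M. indicator (G `` {x}) y *\<^sub>R ?g y \<le> indicator (\<Union>s\<in>?F. A s) y *\<^sub>R ?g y"
          using g_nonneg
        proof eventually_elim
          case (elim y)
          have "indicator (G `` {x}) y \<le> (indicator (\<Union>s\<in>?F. A s) y :: real)"
            using subsetD[OF \<open>G `` {x} \<subseteq> (\<Union>s\<in>?F. A s)\<close>, of y] by (simp add: indicator_def)
          then show ?case using elim by (rule scaleR_right_mono)
        qed
      qed
      also have "\<dots> = (\<Sum>s\<in>?F. LINT y:A s|M. ?g y)"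
        by (rule set_integral_finite_Union[OF fin])
           (use A(4) g_int[OF A(1) finA] A(1) in \<open>auto simp: disjoint_family_on_def\<close>)
      also have "\<dots> = (\<Sum>s\<in>?F. boundary \<Lambda> \<theta> s)" by (intro sum.cong) (auto simp: bd)
      finally show ?thesis .
    qed
    with E' show "\<exists>E\<in>\<E>. \<forall>x\<in>space M. 1 \<le> (\<Sum>s\<in>E `` {x} \<inter> \<Lambda>. boundary \<Lambda> \<theta> s)" by blast
  qed
  with chain\<theta> show ?thesis unfolding ponzi_scheme_def by blast
qed


end

section \<open>From a Ponzi scheme to a mu-Ponzi scheme\<close>

text \<open>Along an enumeration of the index set the partial sums are measurable and, at each point,
  eventually constant.\<close>

lemma borel_measurable_infsum_finite_support:
  fixes f :: "'i \<Rightarrow> 'b \<Rightarrow> real"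
  assumes "countable I" and f: "\<And>i. i \<in> I \<Longrightarrow> f i \<in> borel_measurable N"
    and fin: "\<And>p. p \<in> space N \<Longrightarrow> finite {i \<in> I. f i p \<noteq> 0}"
  shows "(\<lambda>p. \<Sum>\<^sub>\<infinity>i\<in>I. f i p) \<in> borel_measurable N"
proof (rule borel_measurable_LIMSEQ_real)
  let ?J = "\<lambda>n. {i \<in> I. to_nat_on I i < n}"
  have finJ: "finite (?J n)" for n
  proof (rule finite_imageD)
    show "finite (to_nat_on I ` ?J n)" by (rule finite_subset[of _ "{..<n}"]) auto
    show "inj_on (to_nat_on I) (?J n)"
      using inj_on_to_nat_on[OF assms(1)] by (rule inj_on_subset) auto
  qed
  show "(\<lambda>p. \<Sum>i\<in>?J n. f i p) \<in> borel_measurable N" for n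
    using f by (intro borel_measurable_sum) auto
  fix p assume p: "p \<in> space N"
  let ?m = "Max (insert 0 (to_nat_on I ` {i \<in> I. f i p \<noteq> 0}))"
  have le: "to_nat_on I i \<le> ?m" if "i \<in> I" "f i p \<noteq> 0" for i
    using fin[OF p] that by (intro Max_ge) auto
  have "(\<Sum>i\<in>?J n. f i p) = (\<Sum>\<^sub>\<infinity>i\<in>I. f i p)" if "?m < n" for n
  proof -
    have "(\<Sum>\<^sub>\<infinity>i\<in>I. f i p) = (\<Sum>\<^sub>\<infinity>i\<in>?J n. f i p)"
    proof (rule infsum_cong_neutral)
      fix i assume "i \<in> I - ?J n"
      then show "f i p = 0" using le[of i] that by fastforce
    qed auto
    then show ?thesis using finJ by simp
  qed
  then have "eventually (\<lambda>n. (\<Sum>i\<in>?J n. f i p) = (\<Sum>\<^sub>\<infinity>i\<in>I. f i p)) sequentially"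
    using eventually_gt_at_top[of ?m] by (rule eventually_mono[rotated])
  then show "(\<lambda>n. \<Sum>i\<in>?J n. f i p) \<longlonglongrightarrow> (\<Sum>\<^sub>\<infinity>i\<in>I. f i p)"
    by (rule tendsto_eventually)
qed

context uniform_coarse_space
begin

text \<open>The function integrated is \<open>\<Sum>\<^bsub>s\<^esub> g s 1\<^bsub>E `` {s}\<^esub>\<close>, grouped by the points \<open>s\<close> that are
  smeared over \<open>y\<close>; finite support of \<open>g\<close> allows integration term by term.\<close>

lemma
  fixes g :: "'a \<Rightarrow> real"
  assumes S: "uniform_locally_finite (space M) \<E> S" and E: "E \<in> measurable_controlled M \<E>"
    and C: "0 < C" "\<And>s. s \<in> S \<Longrightarrow> emeasure M (E `` {s}) = ennreal C"
    and g: "finite {s \<in> S. g s \<noteq> 0}"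
  shows integrable_fiber_sum: "integrable M (\<lambda>y. \<Sum>s\<in>E\<inverse> `` {y} \<inter> S. g s)"
    and integral_fiber_sum: "(LINT y|M. (\<Sum>s\<in>E\<inverse> `` {y} \<inter> S. g s)) = C * (\<Sum>\<^sub>\<infinity>s\<in>S. g s)"
proof -
  let ?G = "{s \<in> S. g s \<noteq> 0}"
  have Einv: "E\<inverse> \<in> \<E>" using measurable_controlledD(1)[OF E] by (rule controlled_converse)
  have eq: "(\<Sum>s\<in>E\<inverse> `` {y} \<inter> S. g s) = (\<Sum>s\<in>?G. g s * indicator (E `` {s}) y)" for y
  proof -
    have "(\<Sum>s\<in>E\<inverse> `` {y} \<inter> S. g s) = (\<Sum>s\<in>{s \<in> ?G. (s, y) \<in> E}. g s)"
      by (rule sum.mono_neutral_right[OF uniform_locally_finite_sections[OF S Einv]]) auto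
    also have "\<dots> = (\<Sum>s\<in>?G. g s * indicator (E `` {s}) y)"
      using g by (intro sum.mono_neutral_cong_left) (auto simp: indicator_def)
    finally show ?thesis .
  qed
  have int: "integrable M (\<lambda>y. g s * indicator (E `` {s}) y)" for s
    using section_measurable[OF E] section_emeasure_finite[OF E]
    by (intro integrable_mult_right integrable_real_indicator)
  show "integrable M (\<lambda>y. \<Sum>s\<in>E\<inverse> `` {y} \<inter> S. g s)"
    unfolding eq using int by (rule Bochner_Integration.integrable_sum)
  have m: "measure M (E `` {s} \<inter> space M) = C" if "s \<in> S" for s
  proof -
    have "E `` {s} \<inter> space M = E `` {s}"
      using sets.sets_into_space[OF section_measurable[OF E]] by (rule Int_absorb2)
    then show ?thesis using C(1) C(2)[OF that] by (simp add: measure_def)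
  qed
  have "(LINT y|M. (\<Sum>s\<in>E\<inverse> `` {y} \<inter> S. g s)) = (\<Sum>s\<in>?G. LINT y|M. g s * indicator (E `` {s}) y)"
    unfolding eq using int by (rule Bochner_Integration.integral_sum)
  also have "\<dots> = (\<Sum>s\<in>?G. C * g s)"
    by (intro sum.cong) (auto simp: m)
  also have "\<dots> = C * (\<Sum>\<^sub>\<infinity>s\<in>?G. g s)" using g by (simp add: sum_distrib_left)
  also have "(\<Sum>\<^sub>\<infinity>s\<in>?G. g s) = (\<Sum>\<^sub>\<infinity>s\<in>S. g s)" by (rule infsum_cong_neutral) auto
  finally show "(LINT y|M. (\<Sum>s\<in>E\<inverse> `` {y} \<inter> S. g s)) = C * (\<Sum>\<^sub>\<infinity>s\<in>S. g s)" .
qed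

text \<open>The flow \<open>\<Sum>\<^bsub>s, t\<^esub> \<theta> (s, t) 1\<^bsub>E `` {s}\<^esub> x 1\<^bsub>E `` {t}\<^esub> y\<close> in which each \<open>s\<close> is smeared over
  its section; the sums run over the finitely many indices with \<open>x \<in> E `` {s}\<close> and
  \<open>y \<in> E `` {t}\<close>.\<close>

definition spread :: "'a set \<Rightarrow> ('a \<times> 'a) set \<Rightarrow> ('a \<times> 'a \<Rightarrow> real) \<Rightarrow> 'a \<times> 'a \<Rightarrow> real" where
  "spread S E \<theta> p = (\<Sum>s\<in>E\<inverse> `` {fst p} \<inter> S. \<Sum>t\<in>E\<inverse> `` {snd p} \<inter> S. \<theta> (s, t))"

text \<open>The index ranges in the definition depend on the point, so the sum is rewritten as one over the
  fixed countable set \<open>S \<times> S\<close>.\<close>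

lemma spread_measurable:
  assumes S: "uniform_locally_finite (space M) \<E> S" "countable S"
    and E: "E \<in> measurable_controlled M \<E>"
  shows "spread S E \<theta> \<in> borel_measurable (M \<Otimes>\<^sub>M M)"
proof -
  note [measurable] = section_measurable[OF E]
  let ?f = "\<lambda>q p. \<theta> q * (indicator (E `` {fst q}) (fst p) * indicator (E `` {snd q}) (snd p)) :: real"
  let ?D = "\<lambda>p. (E\<inverse> `` {fst p} \<inter> S) \<times> (E\<inverse> `` {snd p} \<inter> S)"
  have Einv: "E\<inverse> \<in> \<E>" using measurable_controlledD(1)[OF E] by (rule controlled_converse)
  have finD: "finite (?D p)" for p
    using uniform_locally_finite_sections[OF S(1) Einv] by (intro finite_cartesian_product)
  have "spread S E \<theta> p = (\<Sum>\<^sub>\<infinity>q\<in>S \<times> S. ?f q p)" for p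
  proof -
    have "(\<Sum>\<^sub>\<infinity>q\<in>S \<times> S. ?f q p) = (\<Sum>\<^sub>\<infinity>q\<in>?D p. \<theta> q)"
      by (rule infsum_cong_neutral) (auto simp: indicator_def)
    also have "\<dots> = spread S E \<theta> p"
      using finD[of p] by (simp add: spread_def sum.cartesian_product split_beta')
    finally show ?thesis by simp
  qed
  moreover have "(\<lambda>p. \<Sum>\<^sub>\<infinity>q\<in>S \<times> S. ?f q p) \<in> borel_measurable (M \<Otimes>\<^sub>M M)"
  proof (rule borel_measurable_infsum_finite_support)
    show "countable (S \<times> S)" using S(2) by (intro countable_SIGMA)
    show "?f q \<in> borel_measurable (M \<Otimes>\<^sub>M M)" for q by measurable
    show "finite {q \<in> S \<times> S. ?f q p \<noteq> 0}" for p
      by (rule finite_subset[OF _ finD[of p]]) (auto simp: indicator_def split: if_splits)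
  qed
  ultimately show ?thesis by presburger
qed

text \<open>Fixing \<open>x\<close> leaves a finite sum over the smeared points near \<open>x\<close>; integrating the other variable
  contributes the factor \<open>C\<close>, the same for all points.  Were the measures of the sections different,
  inflow and outflow would be weighted differently and \<open>\<partial>\<theta>\<close> would not appear.\<close>

lemma mu_boundary_spread:
  assumes S: "uniform_locally_finite (space M) \<E> S" and E: "E \<in> measurable_controlled M \<E>"
    and C: "0 < C" "\<And>s. s \<in> S \<Longrightarrow> emeasure M (E `` {s}) = ennreal C"
    and fin: "\<And>s. s \<in> S \<Longrightarrow> finite {t \<in> S. \<theta> (s, t) \<noteq> 0}" "\<And>t. t \<in> S \<Longrightarrow> finite {s \<in> S. \<theta> (s, t) \<noteq> 0}"
  shows "mu_boundary M (spread S E \<theta>) x = C * (\<Sum>s\<in>E\<inverse> `` {x} \<inter> S. boundary S \<theta> s)"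
proof -
  let ?S = "\<lambda>x. E\<inverse> `` {x} \<inter> S"
  have "(LINT y|M. spread S E \<theta> (x, y)) = (\<Sum>s\<in>?S x. LINT y|M. (\<Sum>t\<in>?S y. \<theta> (s, t)))"
    unfolding spread_def fst_conv snd_conv
    by (rule Bochner_Integration.integral_sum) (use integrable_fiber_sum[OF S E C fin(1)] in auto)
  moreover have "(LINT y|M. spread S E \<theta> (y, x)) = (\<Sum>t\<in>?S x. LINT y|M. (\<Sum>s\<in>?S y. \<theta> (s, t)))"
    unfolding spread_def fst_conv snd_conv
    by (subst sum.swap, rule Bochner_Integration.integral_sum)
       (use integrable_fiber_sum[OF S E C fin(2)] in auto)
  ultimately show ?thesis
    unfolding mu_boundary_def boundary_def
    using integral_fiber_sum[OF S E C fin(1)] integral_fiber_sum[OF S E C fin(2)]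
    by (simp add: sum_distrib_left sum_subtractf right_diff_distrib)
qed

lemma mu_1_chain_if_bounded_flow:
  assumes d: "bounded_flow E C d"
  shows "mu_1_chain M \<E> d"
  unfolding mu_1_chain_def
proof (intro conjI exI bexI)
  show "d \<in> borel_measurable (M \<Otimes>\<^sub>M M)" "E \<in> measurable_controlled M \<E>"
    using d by (rule bounded_flowD)+
  have "\<bar>d p\<bar> \<le> C" for p
    using bounded_flowD(5)[OF d, of p] bounded_flowD(4)[OF d] by (cases "p \<in> E") auto
  then show "AE p in M \<Otimes>\<^sub>M M. \<bar>d p\<bar> \<le> C" by simp
  have "ennreal \<bar>d p\<bar> * indicator (space M \<times> space M - E) p = 0" for p
    using bounded_flow_eq_0[OF d, of p] by (cases "p \<in> E") auto
  then show "(\<integral>\<^sup>+p\<in>space M \<times> space M - E. ennreal \<bar>d p\<bar> \<partial>(M \<Otimes>\<^sub>M M)) = 0"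
    by (simp only: nn_integral_const mult_zero_left)
qed

text \<open>The sets supporting the scheme, its boundary, and the given \<open>S\<close> may be three different ones;
  the first half of the proof moves everything to \<open>S\<close>.  The smeared flow divided by \<open>C\<^sup>2\<close> is then the
  required chain.\<close>

theorem mu_ponzi_scheme_from_ponzi_scheme:
  assumes ponzi: "ponzi_scheme (space M) \<E> \<theta>"
    and S: "uniform_locally_finite (space M) \<E> S"
    and supp: "support_on (space M \<times> space M) \<theta> \<subseteq> S \<times> S"
    and E: "E \<in> measurable_controlled M \<E>" and const: "measure_constant_on M S E"
  shows "\<exists>c. mu_ponzi_scheme M \<E> c"
proof -
  let ?X = "space M"
  obtain C :: real where C: "0 < C" "\<And>s. s \<in> S \<Longrightarrow> emeasure M (E `` {s}) = ennreal C"
    using const by (auto simp: measure_constant_on_def)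
  have SX: "S \<subseteq> ?X" using S by (simp add: uniform_locally_finite_def)
  have "countable S" using S E by (rule countable_if_sections_positive) (simp add: C)
  have Einv: "E\<inverse> \<in> \<E>" using measurable_controlledD(1)[OF E] by (rule controlled_converse)

  obtain S1 where chain1: "uniform_1_chain_on ?X \<E> S1 \<theta>"
    and eff1: "effective_0_chain ?X \<E> (boundary S1 \<theta>)"
    using ponzi by (auto simp: ponzi_scheme_def)
  obtain E1 where S1X: "S1 \<subseteq> ?X" and E1: "E1 \<in> \<E>"
    and supp1: "support_on (?X \<times> ?X) \<theta> \<subseteq> (S1 \<times> S1) \<inter> E1" and bdd\<theta>: "bounded (\<theta> ` (?X \<times> ?X))"
    using chain1 by (auto simp: uniform_1_chain_on_def uniform_locally_finite_def)
  obtain S2 F where chain2: "uniform_0_chain_on ?X \<E> S2 (boundary S1 \<theta>)"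
    and nonneg1: "\<And>x. x \<in> ?X \<Longrightarrow> 0 \<le> boundary S1 \<theta> x"
    and F: "F \<in> \<E>" and eff2: "\<And>x. x \<in> ?X \<Longrightarrow> 1 \<le> (\<Sum>s\<in>F `` {x} \<inter> S2. boundary S1 \<theta> s)"
    using eff1 unfolding effective_0_chain_def by blast
  have \<theta>_supp: "s \<in> S \<and> t \<in> S \<and> s \<in> S1 \<and> t \<in> S1 \<and> (s, t) \<in> E1"
    if "s \<in> ?X" "t \<in> ?X" "\<theta> (s, t) \<noteq> 0" for s t
  proof -
    from that have "(s, t) \<in> support_on (?X \<times> ?X) \<theta>" by (simp add: support_on_def)
    then show ?thesis using supp supp1 by auto
  qed

  let ?\<phi> = "boundary S \<theta>"
  have bd_eq: "boundary S1 \<theta> s = ?\<phi> s" if s: "s \<in> ?X" for s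
    unfolding boundary_def
    by (intro arg_cong2[where f = "(-)"] infsum_cong_neutral)
       (use \<theta>_supp[OF _ s] \<theta>_supp[OF s] SX S1X in blast)+
  have \<phi>_out: "?\<phi> s = 0" if "s \<in> ?X" "s \<notin> S" for s
  proof -
    have "\<theta> (t, s) = 0" "\<theta> (s, t) = 0" if "t \<in> S" for t
      using \<theta>_supp[of t s] \<theta>_supp[of s t] \<open>s \<in> ?X\<close> \<open>s \<notin> S\<close> that SX by blast+
    then show ?thesis unfolding boundary_def by (simp add: infsum_0)
  qed
  have \<phi>_nonneg: "0 \<le> ?\<phi> s" if "s \<in> S" for s
    using nonneg1[of s] bd_eq[of s] SX that by auto
  have eff: "1 \<le> (\<Sum>s\<in>F `` {x} \<inter> S. ?\<phi> s)" if x: "x \<in> ?X" for x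
  proof -
    have S2: "uniform_locally_finite ?X \<E> S2" "support_on ?X (boundary S1 \<theta>) \<subseteq> S2"
      using chain2 by (auto simp: uniform_0_chain_on_def)
    have S2X: "S2 \<subseteq> ?X" using S2(1) by (simp add: uniform_locally_finite_def)
    have \<phi>_out2: "?\<phi> s = 0" if "s \<in> S" "s \<notin> S2" for s
    proof (rule ccontr)
      assume "?\<phi> s \<noteq> 0"
      then have "s \<in> support_on ?X (boundary S1 \<theta>)"
        using bd_eq[of s] SX that(1) by (auto simp: support_on_def)
      then show False using S2(2) that(2) by blast
    qed
    have "(\<Sum>s\<in>F `` {x} \<inter> S2. boundary S1 \<theta> s) = (\<Sum>s\<in>F `` {x} \<inter> S2. ?\<phi> s)"
      using S2X by (intro sum.cong) (auto intro: bd_eq)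
    also have "\<dots> = (\<Sum>s\<in>F `` {x} \<inter> S2 \<inter> S. ?\<phi> s)"
      using uniform_locally_finite_sections[OF S2(1) F] \<phi>_out S2X
      by (intro sum.mono_neutral_right) auto
    also have "\<dots> = (\<Sum>s\<in>F `` {x} \<inter> S. ?\<phi> s)"
      using uniform_locally_finite_sections[OF S F] \<phi>_out2
      by (intro sum.mono_neutral_left) auto
    finally show ?thesis using eff2[OF x] by simp
  qed
  have fin: "finite {t \<in> S. \<theta> (s, t) \<noteq> 0}" "finite {s \<in> S. \<theta> (s, t) \<noteq> 0}" if "s \<in> S" "t \<in> S" for s t
  proof -
    have "{t \<in> S. \<theta> (s, t) \<noteq> 0} \<subseteq> E1 `` {s} \<inter> S" using \<theta>_supp that SX by auto
    then show "finite {t \<in> S. \<theta> (s, t) \<noteq> 0}"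
      by (rule finite_subset) (rule uniform_locally_finite_sections[OF S E1])
    have "{s \<in> S. \<theta> (s, t) \<noteq> 0} \<subseteq> E1\<inverse> `` {t} \<inter> S" using \<theta>_supp that SX by auto
    then show "finite {s \<in> S. \<theta> (s, t) \<noteq> 0}"
      by (rule finite_subset) (rule uniform_locally_finite_sections[OF S controlled_converse[OF E1]])
  qed

  let ?S = "\<lambda>x. E\<inverse> `` {x} \<inter> S"
  have finS: "finite (?S x)" for x using S Einv by (rule uniform_locally_finite_sections)
  obtain N where "\<And>x. x \<in> ?X \<Longrightarrow> card (?S x) \<le> N"
    using S Einv unfolding uniform_locally_finite_def by blast
  moreover have "?S x = {}" if "x \<notin> ?X" for x
    using controlled_subset_space[OF Einv] that by auto
  ultimately have N: "card (?S x) \<le> N" for x by (cases "x \<in> ?X") auto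
  obtain T where T: "0 < T" "\<And>p. p \<in> ?X \<times> ?X \<Longrightarrow> \<bar>\<theta> p\<bar> \<le> T"
    using bdd\<theta> unfolding bounded_pos by auto
  have sum_le: "\<bar>\<Sum>s\<in>?S x. h s\<bar> \<le> N * B" if "\<And>s. s \<in> S \<Longrightarrow> \<bar>h s\<bar> \<le> B" "0 \<le> B"
    for x and B :: real and h :: "'a \<Rightarrow> real"
  proof -
    have "\<bar>\<Sum>s\<in>?S x. h s\<bar> \<le> (\<Sum>s\<in>?S x. \<bar>h s\<bar>)" by (rule sum_abs)
    also have "\<dots> \<le> card (?S x) * B" using that(1) by (intro sum_bounded_above) auto
    also have "\<dots> \<le> N * B" using N[of x] that(2) by (intro mult_right_mono) auto
    finally show ?thesis .
  qed
  let ?c = "spread S E \<theta>"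
  have c_le: "\<bar>?c p\<bar> \<le> N * (N * T)" for p
    unfolding spread_def using T SX by (intro sum_le) auto
  have "E\<inverse> O E1 O E \<in> \<E>"
    using Einv E1 measurable_controlledD(1)[OF E] by (intro controlled_comp)
  then obtain W where W: "W \<in> measurable_controlled M \<E>" "E\<inverse> O E1 O E \<subseteq> W" "W\<inverse> = W"
    using symmetric_measurable_hull by blast
  have c_out: "?c p = 0" if "p \<notin> W" for p
  proof -
    have "\<theta> (s, t) = 0" if st: "s \<in> ?S (fst p)" "t \<in> ?S (snd p)" for s t
    proof (rule ccontr)
      assume "\<theta> (s, t) \<noteq> 0"
      then have "(s, t) \<in> E1" using \<theta>_supp[of s t] st SX by auto
      then have "(fst p, snd p) \<in> E\<inverse> O E1 O E"
        using st by (intro relcompI[of "fst p" s] relcompI[of s t]) auto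
      then show False using W(2) \<open>p \<notin> W\<close> by (auto simp only: prod.collapse)
    qed
    then show ?thesis by (simp add: spread_def)
  qed
  define d where "d p = ?c p / C\<^sup>2" for p
  note [measurable] = spread_measurable[OF S \<open>countable S\<close> E, of \<theta>]
  have d: "bounded_flow W (N * (N * T) / C\<^sup>2) d"
    unfolding bounded_flow_def
  proof (intro conjI allI)
    show "d \<in> borel_measurable (M \<Otimes>\<^sub>M M)" unfolding d_def by measurable
    show "0 \<le> N * (N * T) / C\<^sup>2" using T(1) by simp
    show "\<bar>d p\<bar> \<le> N * (N * T) / C\<^sup>2 * indicator W p" for p
      using c_le[of p] c_out[of p] by (cases "p \<in> W") (auto simp: d_def divide_right_mono)
  qed (fact W)+
  have bd_d: "mu_boundary M d x = (\<Sum>s\<in>?S x. ?\<phi> s) / C" for x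
  proof -
    have "mu_boundary M d x = mu_boundary M ?c x / C\<^sup>2"
      by (simp add: mu_boundary_def d_def diff_divide_distrib)
    also have "\<dots> = (C * (\<Sum>s\<in>?S x. ?\<phi> s)) / C\<^sup>2"
      by (subst mu_boundary_spread[OF S E C]) (use fin in auto)
    finally show ?thesis using C(1) by (simp add: power2_eq_square)
  qed
  have "bounded (boundary S1 \<theta> ` ?X)" using chain2 by (simp add: uniform_0_chain_on_def)
  then obtain B where B: "0 < B" "\<And>x. x \<in> ?X \<Longrightarrow> \<bar>boundary S1 \<theta> x\<bar> \<le> B"
    unfolding bounded_pos by auto
  have \<phi>_le: "\<bar>?\<phi> s\<bar> \<le> B" if "s \<in> S" for s
    using B(2)[of s] bd_eq[of s] SX that by auto
  have "effective_mu_0_chain M \<E> (mu_boundary M d)"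
    unfolding effective_mu_0_chain_def
  proof (intro conjI)
    have "\<bar>mu_boundary M d x\<bar> \<le> N * B / C" for x
      using sum_le[OF \<phi>_le] B(1) C(1) by (simp add: bd_d divide_right_mono)
    then have "AE x in M. \<bar>mu_boundary M d x\<bar> \<le> N * B / C" by simp
    then show "mu_0_chain M (mu_boundary M d)"
      using mu_boundary_measurable[OF bounded_flowD(1)[OF d]] unfolding mu_0_chain_def by blast
    show "AE x in M. 0 \<le> mu_boundary M d x"
      using C(1) \<phi>_nonneg by (intro AE_I2) (auto simp: bd_d intro!: divide_nonneg_pos sum_nonneg)
    \<comment> \<open>If \<open>(x, s) \<in> F\<close>, the whole smeared point \<open>E `` {s}\<close> lies in \<open>(F O E) `` {x}\<close>.\<close>
    have "F O E \<in> \<E>" using F measurable_controlledD(1)[OF E] by (rule controlled_comp)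
    then obtain H where H: "H \<in> measurable_controlled M \<E>" "F O E \<subseteq> H" by (rule measurable_hull)
    have "1 \<le> (LINT y:H `` {x}|M. mu_boundary M d y)" if x: "x \<in> ?X" for x
    proof -
      \<comment> \<open>Restricting the gain to \<open>F `` {x}\<close> makes it finitely supported and loses only nonnegative terms.\<close>
      let ?g = "\<lambda>s. if s \<in> F `` {x} then ?\<phi> s else 0"
      have "{s \<in> S. ?g s \<noteq> 0} \<subseteq> F `` {x} \<inter> S" by auto
      then have fing: "finite {s \<in> S. ?g s \<noteq> 0}"
        by (rule finite_subset) (rule uniform_locally_finite_sections[OF S F])
      have "1 \<le> (\<Sum>s\<in>F `` {x} \<inter> S. ?\<phi> s)" using x by (rule eff)
      also have "\<dots> = (\<Sum>\<^sub>\<infinity>s\<in>F `` {x} \<inter> S. ?\<phi> s)"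
        using uniform_locally_finite_sections[OF S F] by simp
      also have "\<dots> = (\<Sum>\<^sub>\<infinity>s\<in>S. ?g s)" by (rule infsum_cong_neutral) auto
      also have "\<dots> = (LINT y|M. (\<Sum>s\<in>?S y. ?g s)) / C"
        using C(1) by (subst integral_fiber_sum[OF S E C fing]) auto
      also have "\<dots> = (LINT y|M. (\<Sum>s\<in>?S y. ?g s) / C)" by simp
      also have "\<dots> \<le> (LINT y:H `` {x}|M. mu_boundary M d y)"
        unfolding set_lebesgue_integral_def
      proof (rule integral_mono)
        show "integrable M (\<lambda>y. (\<Sum>s\<in>?S y. ?g s) / C)"
          using integrable_fiber_sum[OF S E C fing] by (rule integrable_divide)
        show "integrable M (\<lambda>y. indicator (H `` {x}) y *\<^sub>R mu_boundary M d y)"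
          using integral_mu_boundary(1)[OF d section_measurable[OF H(1)] section_emeasure_finite[OF H(1)]]
          by (simp add: set_integrable_def)
        fix y
        show "(\<Sum>s\<in>?S y. ?g s) / C \<le> indicator (H `` {x}) y *\<^sub>R mu_boundary M d y"
        proof (cases "y \<in> H `` {x}")
          case True
          have "(\<Sum>s\<in>?S y. ?g s) \<le> (\<Sum>s\<in>?S y. ?\<phi> s)"
            using \<phi>_nonneg by (intro sum_mono) auto
          then show ?thesis using True C(1) by (simp add: bd_d divide_right_mono)
        next
          case False
          have "?g s = 0" if "s \<in> ?S y" for s using that False H(2) by auto
          then have "(\<Sum>s\<in>?S y. ?g s) = 0" by (rule sum.neutral[OF ballI])
          with False show ?thesis by simp
        qed
      qed
      finally show ?thesis .
    qed
    with H(1) show "\<exists>E\<in>measurable_controlled M \<E>. \<forall>x\<in>?X. 1 \<le> (LINT y:E `` {x}|M. mu_boundary M d y)"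
      by blast
  qed
  with mu_1_chain_if_bounded_flow[OF d] show ?thesis unfolding mu_ponzi_scheme_def by blast
qed

end

theorem theorem1:
  fixes M :: "'a measure" and \<E> :: "('a \<times> 'a) set set"
  assumes "measurable_coarse_space M \<E>"
    and "uniform_wrt M \<E>"
    and "sigma_finite_measure M"
  shows "((\<exists>c. mu_ponzi_scheme M \<E> c) \<and> (\<exists>\<Lambda>. quasi_lattice (space M) \<E> \<Lambda>)
            \<longrightarrow> (\<exists>\<theta>. ponzi_scheme (space M) \<E> \<theta>)) \<and>
         (\<forall>\<theta> S. ponzi_scheme (space M) \<E> \<theta> \<and>
            uniform_locally_finite (space M) \<E> S \<and>
            support_on (space M \<times> space M) \<theta> \<subseteq> S \<times> S \<and>
            (\<exists>E\<in>measurable_controlled M \<E>. measure_constant_on M S E)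
            \<longrightarrow> (\<exists>c. mu_ponzi_scheme M \<E> c))"
proof (intro conjI impI allI)
  interpret uniform_coarse_space M \<E>
    using assms by (intro uniform_coarse_space.intro uniform_coarse_space_axioms.intro)
  show "\<exists>\<theta>. ponzi_scheme (space M) \<E> \<theta>"
    if "(\<exists>c. mu_ponzi_scheme M \<E> c) \<and> (\<exists>\<Lambda>. quasi_lattice (space M) \<E> \<Lambda>)"
    using that ponzi_scheme_from_mu_ponzi_scheme by blast
  show "\<exists>c. mu_ponzi_scheme M \<E> c"
    if "ponzi_scheme (space M) \<E> \<theta> \<and> uniform_locally_finite (space M) \<E> S \<and>
        support_on (space M \<times> space M) \<theta> \<subseteq> S \<times> S \<and>
        (\<exists>E\<in>measurable_controlled M \<E>. measure_constant_on M S E)" for \<theta> S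
    using that mu_ponzi_scheme_from_ponzi_scheme by blast
qed

end
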